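(* For all integers $h,b\ge1$, $p\ge0$, and $r\in(0,1)$, there exist constants $c_1\ge c_2>0$ and $n_0$ such that for any $n\ge n_0$ and labels $\mathcal{Y}$: 1. No classifier $\mathcal{C}:\mathcal{I}_{n,h,b}\to\mathcal{Y}$ induces an interesting class that is $r$-robust to $L^p$-perturbations of size $c_1n^{1/\max(p,1)}$. 2. There exists a classifier $\mathcal{C}:\mathcal{I}_{n,h,b}\to\mathcal{Y}$ which induces an interesting class that is $r$-robust to $L^p$-perturbations of size $c_2n^{1/\max(p,1)}$.
   Context: Here $h,b,p$ are integers, $r$ is a real number, and $\mathcal{Y}$ is a finite set of labels. For integers $n,h,b\ge1$, $\mathcal{I}_{n,h,b}$ is the finite set of all real tensors of shape $(n,n,h)$ each of whose entries lies in the set of $2^b$ equally spaced values $\{x/(2^b-1): x=0,1,\dots,2^b-1\}\subset[0,1]$ ("images"). For a tensor $A$ and an integer $p\ge1$, $\|A\|_p$ is the $p$th root of the sum of the $p$th powers of the absolute values of the entries of $A$; $\|A\|_0$ is the number of nonzero entries of $A$. A classifier is a function $\mathcal{C}:\mathcal{I}_{n,h,b}\to\mathcal{Y}$ with $\mathcal{Y}$ a finite set of labels; the classes induced by $\mathcal{C}$ are the preimages $\mathcal{C}^{-1}(y)$, $y\in\mathcal{Y}$. A class is interesting if it is nonempty and contains no more than half of the elements of $\mathcal{I}_{n,h,b}$. An image $I$ is robust to $L^p$-perturbations of size $d$ if for all $I'\in\mathcal{I}_{n,h,b}$, $\|I-I'\|_p\le d$ implies $\mathcal{C}(I)=\mathcal{C}(I')$.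 A class $C$ is $r$-robust to $L^p$-perturbations of size $d$ if $C$ is nonempty and the number of images $I\in C$ that are robust to $L^p$-perturbations of size $d$ is at least $r|C|$.
   Formalization: Part 2 is stated for label sets with at least two labels, since with one label the only class is all images and with none there is no classifier; label sets are finite subsets of a fixed type (the natural numbers suffice by relabelling). *)

theory Defs
  imports Complex_Main "HOL-Library.FuncSet"
begin

text \<open>A tensor of shape \<open>(n, n, h)\<close> is a function on \<open>tensor_index n h\<close>. Images are taken
  extensional (\<open>undefined\<close> outside the index set), so that equality of images is equality of
  tensors and \<open>card\<close> counts tensors.\<close>

type_synonym tensor = "nat \<times> nat \<times> nat \<Rightarrow> real"

definition tensor_index :: "nat \<Rightarrow> nat \<Rightarrow> (nat \<times> nat \<times> nat) set" where
  "tensor_index n h = {..<n} \<times> {..<n} \<times> {..<h}"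

definition levels :: "nat \<Rightarrow> real set" where
  "levels b = {real x / (2 ^ b - 1) | x :: nat. x \<le> 2 ^ b - 1}"

definition images :: "nat \<Rightarrow> nat \<Rightarrow> nat \<Rightarrow> tensor set" where
  "images n h b = tensor_index n h \<rightarrow>\<^sub>E levels b"

definition lp_norm :: "nat \<Rightarrow> nat \<Rightarrow> nat \<Rightarrow> tensor \<Rightarrow> real" where
  "lp_norm n h p A =
     (if p = 0 then real (card {i \<in> tensor_index n h. A i \<noteq> 0})
      else root p (\<Sum>i\<in>tensor_index n h. \<bar>A i\<bar> ^ p))"

definition classifiers :: "nat \<Rightarrow> nat \<Rightarrow> nat \<Rightarrow> 'y set \<Rightarrow> (tensor \<Rightarrow> 'y) set" where
  "classifiers n h b Y = images n h b \<rightarrow>\<^sub>E Y"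

definition induced_classes ::
    "nat \<Rightarrow> nat \<Rightarrow> nat \<Rightarrow> 'y set \<Rightarrow> (tensor \<Rightarrow> 'y) \<Rightarrow> tensor set set" where
  "induced_classes n h b Y C = {{I \<in> images n h b. C I = y} | y. y \<in> Y}"

definition interesting_class :: "nat \<Rightarrow> nat \<Rightarrow> nat \<Rightarrow> tensor set \<Rightarrow> bool" where
  "interesting_class n h b K \<longleftrightarrow>
     K \<noteq> {} \<and> real (card K) \<le> real (card (images n h b)) / 2"

definition robust_image ::
    "nat \<Rightarrow> nat \<Rightarrow> nat \<Rightarrow> (tensor \<Rightarrow> 'y) \<Rightarrow> nat \<Rightarrow> real \<Rightarrow> tensor \<Rightarrow> bool" where
  "robust_image n h b C p d I \<longleftrightarrow>
     (\<forall>I'\<in>images n h b. lp_norm n h p (\<lambda>i. I i - I' i) \<le> d \<longrightarrow> C I = C I')"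

definition robust_class ::
    "nat \<Rightarrow> nat \<Rightarrow> nat \<Rightarrow> (tensor \<Rightarrow> 'y) \<Rightarrow> real \<Rightarrow> nat \<Rightarrow> real \<Rightarrow> tensor set \<Rightarrow> bool" where
  "robust_class n h b C r p d K \<longleftrightarrow>
     K \<noteq> {} \<and> real (card {I \<in> K. robust_image n h b C p d I}) \<ge> r * real (card K)"

end

theory Submission
  imports Defs "HOL-Analysis.L2_Norm"
begin

text \<open>Since entries differ by at most 1 and, when distinct, by at least \<open>1 / (2 ^ b - 1)\<close>, an
  \<open>L\<^sup>p\<close>-perturbation of size of order \<open>n powr (1/p)\<close> is the same, up to constants, as a change of
  order \<open>n\<close> coordinates, that is, of order the square root of their total number \<open>N = n\<^sup>2 h\<close>.

  Upper bound: an isoperimetric inequality shows that a set \<open>A\<close> of density at most 1/2 has at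
  least \<open>card A / (2 sqrt N)\<close> points on lines that meet both \<open>A\<close> and its complement. The points
  of this kind for the \<open>(k+1)\<close>-neighbourhood of \<open>A\<close> lie in the \<open>(k+2)\<close>-neighbourhood but not in
  the \<open>k\<close>-neighbourhood, so each two steps add \<open>card A / (2 sqrt N)\<close> points, and after order
  \<open>sqrt N\<close> steps the robust part of a class outgrows the class.

  Lower bound: split the levels into two halves and take the images with fewer than \<open>N/2\<close>
  entries in the upper half. No binomial coefficient \<open>N choose k\<close> exceeds \<open>2 ^ N / sqrt N\<close>, so
  only a small part of this class is within \<open>c sqrt N\<close> changes of its complement.\<close>

section \<open>Isoperimetry in finite product spaces\<close>

definition mean :: "'a set \<Rightarrow> ('a \<Rightarrow> real) \<Rightarrow> real" where
  "mean S f = (\<Sum>x\<in>S. f x) / real (card S)"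

lemma mean_mono: "(\<And>x. x \<in> S \<Longrightarrow> f x \<le> g x) \<Longrightarrow> mean S f \<le> mean S g"
  unfolding mean_def by (intro divide_right_mono sum_mono) auto

lemma mean_nonneg: "(\<And>x. x \<in> S \<Longrightarrow> 0 \<le> f x) \<Longrightarrow> 0 \<le> mean S f"
  unfolding mean_def by (intro divide_nonneg_nonneg sum_nonneg) auto

lemma mean_const: "finite S \<Longrightarrow> S \<noteq> {} \<Longrightarrow> mean S (\<lambda>_. c) = c"
  unfolding mean_def by simp

lemma mean_cong: "(\<And>x. x \<in> S \<Longrightarrow> f x = g x) \<Longrightarrow> mean S f = mean S g"
  unfolding mean_def by simp

lemma mean_diff: "mean S (\<lambda>x. f x - g x) = mean S f - mean S g"
  unfolding mean_def by (simp add: sum_subtractf diff_divide_distrib)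

lemma mean_cmult: "mean S (\<lambda>x. c * f x) = c * mean S f"
  unfolding mean_def by (simp add: sum_distrib_left)

lemma abs_mean_le: "\<bar>mean S f\<bar> \<le> mean S (\<lambda>x. \<bar>f x\<bar>)"
  unfolding mean_def by (simp add: divide_right_mono)

text \<open>Fubini for uniform averages, through the bijection sending \<open>(y, g)\<close> to
  \<open>g(j := y)\<close>. It peels off one coordinate in the induction on the index set.\<close>

lemma mean_PiE_insert:
  assumes "j \<notin> I"
  shows "mean (insert j I \<rightarrow>\<^sub>E Q) f = mean (I \<rightarrow>\<^sub>E Q) (\<lambda>x. mean Q (\<lambda>y. f (x(j := y))))"
proof -
  let ?h = "\<lambda>(y, g). g(j := y)"
  have inj: "inj_on ?h (Q \<times> (I \<rightarrow>\<^sub>E Q))"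
    using inj_combinator[OF assms, of "\<lambda>_. Q"] by simp
  have eq: "insert j I \<rightarrow>\<^sub>E Q = ?h ` (Q \<times> (I \<rightarrow>\<^sub>E Q))"
    by (simp add: PiE_insert_eq)
  have s: "(\<Sum>x\<in>insert j I \<rightarrow>\<^sub>E Q. f x) = (\<Sum>x\<in>I \<rightarrow>\<^sub>E Q. \<Sum>y\<in>Q. f (x(j := y)))"
    unfolding eq sum.reindex[OF inj]
    by (subst sum.swap) (simp add: sum.cartesian_product case_prod_unfold)
  have c: "card (insert j I \<rightarrow>\<^sub>E Q) = card Q * card (I \<rightarrow>\<^sub>E Q)"
    unfolding eq card_image[OF inj] by (rule card_cartesian_product)
  show ?thesis
    unfolding mean_def s c by (simp add: sum_divide_distrib[symmetric] mult.commute)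
qed

text \<open>The triangle inequality for the Euclidean norm of the vectors with components
  \<open>a w\<close> and all \<open>v i w\<close>. The first component is kept apart because it will
  carry \<open>f (1 - f)\<close>, while the others carry the gradient.\<close>

lemma sqrt_sum_squares_sum_le:
  "sqrt ((\<Sum>w\<in>W. a w)\<^sup>2 + (L2_set (\<lambda>i. \<Sum>w\<in>W. v i w) S)\<^sup>2)
    \<le> (\<Sum>w\<in>W. sqrt ((a w)\<^sup>2 + (L2_set (\<lambda>i. v i w) S)\<^sup>2))"
proof (induction W rule: infinite_finite_induct)
  case (insert w W)
  have "sqrt ((a w + sum a W)\<^sup>2 + (L2_set (\<lambda>i. v i w + sum (v i) W) S)\<^sup>2)
     \<le> sqrt ((a w + sum a W)\<^sup>2 + (L2_set (\<lambda>i. v i w) S + L2_set (\<lambda>i. sum (v i) W) S)\<^sup>2)"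
    by (intro real_sqrt_le_mono add_left_mono power_mono L2_set_triangle_ineq L2_set_nonneg)
  also have "\<dots> \<le> sqrt ((a w)\<^sup>2 + (L2_set (\<lambda>i. v i w) S)\<^sup>2)
      + sqrt ((sum a W)\<^sup>2 + (L2_set (\<lambda>i. sum (v i) W) S)\<^sup>2)"
    by (rule real_sqrt_sum_squares_triangle_ineq)
  finally show ?case
    using insert by simp
qed (simp_all add: L2_set_def)

text \<open>Convexity of that norm: the previous bound scaled by \<open>1 / card W\<close>. In the
  induction it moves the average over the new coordinate outside the square root.\<close>

lemma sqrt_sum_squares_mean_le:
  "sqrt ((mean W a)\<^sup>2 + (L2_set (\<lambda>i. mean W (v i)) S)\<^sup>2)
    \<le> mean W (\<lambda>w. sqrt ((a w)\<^sup>2 + (L2_set (\<lambda>i. v i w) S)\<^sup>2))"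
proof -
  define c where "c = inverse (real (card W))"
  have c: "c \<ge> 0" by (simp add: c_def)
  have "sqrt ((mean W a)\<^sup>2 + (L2_set (\<lambda>i. mean W (v i)) S)\<^sup>2)
      = sqrt (c\<^sup>2 * ((sum a W)\<^sup>2 + (L2_set (\<lambda>i. sum (v i) W) S)\<^sup>2))"
    unfolding mean_def divide_inverse c_def[symmetric] L2_set_left_distrib[OF c, symmetric]
    by (simp add: algebra_simps power_mult_distrib)
  also have "\<dots> = c * sqrt ((sum a W)\<^sup>2 + (L2_set (\<lambda>i. sum (v i) W) S)\<^sup>2)"
    using c by (simp add: real_sqrt_mult)
  also have "\<dots> \<le> c * (\<Sum>w\<in>W. sqrt ((a w)\<^sup>2 + (L2_set (\<lambda>i. v i w) S)\<^sup>2))"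
    by (intro mult_left_mono c sqrt_sum_squares_sum_le)
  finally show ?thesis
    by (simp add: mean_def c_def divide_inverse mult.commute)
qed

text \<open>The one-coordinate case. Passing from \<open>J = m (1 - m)\<close> to the average of
  \<open>f (1 - f)\<close> loses exactly the variance \<open>V\<close> of \<open>f\<close>, and the
  oscillation bound controls \<open>V\<close>.\<close>

lemma mean_times_compl_le:
  fixes f :: "'a \<Rightarrow> real"
  assumes Q: "finite Q" "Q \<noteq> {}"
    and f: "\<And>y. y \<in> Q \<Longrightarrow> 0 \<le> f y \<and> f y \<le> 1"
    and osc: "\<And>y z. y \<in> Q \<Longrightarrow> z \<in> Q \<Longrightarrow> \<bar>f y - f z\<bar> \<le> \<delta>"
  shows "(mean Q f * (1 - mean Q f))\<^sup>2 \<le> (mean Q (\<lambda>y. f y * (1 - f y)))\<^sup>2 + \<delta>\<^sup>2"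
proof -
  define m where "m = mean Q f"
  define V where "V = mean Q (\<lambda>y. (f y - m)\<^sup>2)"
  define J where "J = m * (1 - m)"
  have sq: "mean Q (\<lambda>y. f y * (1 - f y)) = J - V"
  proof -
    have "V = mean Q (\<lambda>y. (f y - f y * (1 - f y)) - (2 * m * f y - m\<^sup>2))"
      unfolding V_def by (intro mean_cong) (simp add: power2_eq_square algebra_simps)
    also have "\<dots> = (m - mean Q (\<lambda>y. f y * (1 - f y))) - (2 * m * m - m\<^sup>2)"
      by (simp add: mean_diff mean_cmult mean_const[OF Q] m_def)
    finally show ?thesis
      by (simp add: J_def power2_eq_square algebra_simps)
  qed
  have dev: "\<bar>f y - m\<bar> \<le> \<delta>" if "y \<in> Q" for y
  proof -
    have "f y - m = mean Q (\<lambda>z. f y - f z)"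
      by (simp add: mean_diff mean_const[OF Q] m_def)
    also have "\<bar>\<dots>\<bar> \<le> mean Q (\<lambda>z. \<bar>f y - f z\<bar>)"
      by (rule abs_mean_le)
    also have "\<dots> \<le> mean Q (\<lambda>_. \<delta>)"
      by (intro mean_mono osc that)
    finally show ?thesis
      by (simp add: mean_const[OF Q])
  qed
  have "V \<le> mean Q (\<lambda>_. \<delta>\<^sup>2)"
    unfolding V_def using dev by (intro mean_mono abs_le_square_iff[THEN iffD1]) fastforce
  then have V: "V \<le> \<delta>\<^sup>2" "0 \<le> V"
    by (auto simp: mean_const[OF Q] V_def intro: mean_nonneg)
  have "J = 1/4 - (m - 1/2)\<^sup>2"
    by (simp add: J_def power2_eq_square algebra_simps)
  then have "J \<le> 1/4"
    by simp
  then have "2 * J * V \<le> 2 * (1/4) * V"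
    using V by (intro mult_right_mono) auto
  \<comment> \<open>Here \<open>J^2 - (J - V)^2 = 2 J V - V^2\<close>, which is at most
    \<open>V / 2\<close> since \<open>J \<le> 1/4\<close>.\<close>
  then have "J\<^sup>2 \<le> (J - V)\<^sup>2 + \<delta>\<^sup>2"
    using V zero_le_power2[of V] by (simp add: power2_diff)
  then show ?thesis
    by (simp add: sq J_def m_def)
qed

text \<open>A weak form of Bobkov's functional isoperimetric inequality. The function
  \<open>x (1 - x)\<close> replaces the Gaussian isoperimetric profile, which makes the inequality for one
  coordinate elementary, and \<open>D i x\<close> bounds the oscillation of \<open>f\<close> on the line through \<open>x\<close> in
  direction \<open>i\<close>. Leaving \<open>D\<close> arbitrary lets the induction average it along with \<open>f\<close>.\<close>

lemma mean_times_compl_le_mean_gradient: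
  fixes f :: "('i \<Rightarrow> 'a) \<Rightarrow> real"
  assumes I: "finite I" and Q: "finite Q" "Q \<noteq> {}"
    and "\<And>x. x \<in> I \<rightarrow>\<^sub>E Q \<Longrightarrow> 0 \<le> f x \<and> f x \<le> 1"
    and "\<And>i x y z. \<lbrakk>i \<in> I; x \<in> I \<rightarrow>\<^sub>E Q; y \<in> Q; z \<in> Q\<rbrakk>
           \<Longrightarrow> \<bar>f (x(i := y)) - f (x(i := z))\<bar> \<le> D i x"
  shows "mean (I \<rightarrow>\<^sub>E Q) f * (1 - mean (I \<rightarrow>\<^sub>E Q) f)
    \<le> mean (I \<rightarrow>\<^sub>E Q) (\<lambda>x. sqrt ((f x * (1 - f x))\<^sup>2 + (L2_set (\<lambda>i. D i x) I)\<^sup>2))"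
  using I assms(4,5)
proof (induction I arbitrary: f D rule: finite_induct)
  case empty
  then show ?case
    by (simp add: mean_def L2_set_def)
next
  case (insert j I)
  let ?X = "I \<rightarrow>\<^sub>E Q"
  \<comment> \<open>Averaging over coordinate \<open>j\<close> turns \<open>f\<close> and
    \<open>D\<close> into data on the smaller cube that again satisfy both hypotheses.\<close>
  define g where "g x = mean Q (\<lambda>w. f (x(j := w)))" for x
  define D' where "D' i x = mean Q (\<lambda>w. D i (x(j := w)))" for i x
  have upd: "x(j := w) \<in> insert j I \<rightarrow>\<^sub>E Q" if "x \<in> ?X" "w \<in> Q" for x w
    using that by (intro PiE_fun_upd)
  have f01: "0 \<le> f (x(j := w)) \<and> f (x(j := w)) \<le> 1" if "x \<in> ?X" "w \<in> Q" for x w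
    by (rule insert.prems(1)[OF upd[OF that]])
  have g01: "0 \<le> g x \<and> g x \<le> 1" if "x \<in> ?X" for x
  proof -
    have "g x \<le> mean Q (\<lambda>_. 1)"
      unfolding g_def using f01[OF that] by (intro mean_mono) auto
    then show ?thesis
      unfolding g_def using f01[OF that] by (auto intro!: mean_nonneg simp: mean_const[OF Q])
  qed
  have D': "\<bar>g (x(i := y)) - g (x(i := z))\<bar> \<le> D' i x"
    if "i \<in> I" "x \<in> ?X" "y \<in> Q" "z \<in> Q" for i x y z
  proof -
    have ij: "i \<noteq> j"
      using that insert.hyps by auto
    have "g (x(i := y)) - g (x(i := z))
        = mean Q (\<lambda>w. f (x(j := w, i := y)) - f (x(j := w, i := z)))"
      unfolding g_def mean_diff using ij by (simp add: fun_upd_twist)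
    also have "\<bar>\<dots>\<bar> \<le> mean Q (\<lambda>w. \<bar>f (x(j := w, i := y)) - f (x(j := w, i := z))\<bar>)"
      by (rule abs_mean_le)
    also have "\<dots> \<le> D' i x"
      unfolding D'_def using that by (intro mean_mono insert.prems(2) upd) auto
    finally show ?thesis .
  qed
  let ?R = "\<lambda>x. sqrt ((f x * (1 - f x))\<^sup>2 + (L2_set (\<lambda>i. D i x) (insert j I))\<^sup>2)"
  have step: "sqrt ((g x * (1 - g x))\<^sup>2 + (L2_set (\<lambda>i. D' i x) I)\<^sup>2)
      \<le> mean Q (\<lambda>w. ?R (x(j := w)))" if x: "x \<in> ?X" for x
  proof -
    \<comment> \<open>The update at \<open>j\<close> overwrites \<open>w\<close>, so each
      \<open>D j (x(j := w))\<close> bounds the same difference, and hence so does their average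
      over \<open>w\<close>.\<close>
    have osc: "\<bar>f (x(j := y)) - f (x(j := z))\<bar> \<le> D' j x" if "y \<in> Q" "z \<in> Q" for y z
    proof -
      have "mean Q (\<lambda>w. \<bar>f (x(j := y)) - f (x(j := z))\<bar>) \<le> D' j x"
        unfolding D'_def
      proof (rule mean_mono)
        fix w assume "w \<in> Q"
        then show "\<bar>f (x(j := y)) - f (x(j := z))\<bar> \<le> D j (x(j := w))"
          using insert.prems(2)[OF insertI1 upd[OF x] that, of w] by (simp only: fun_upd_upd)
      qed
      then show ?thesis
        by (simp add: mean_const[OF Q])
    qed
    \<comment> \<open>The one-coordinate inequality pays for exchanging \<open>g (1 - g)\<close>
      with the averaged \<open>f (1 - f)\<close>; its error term is precisely the new component
      \<open>D' j x\<close> of the gradient.\<close>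
    have "(g x * (1 - g x))\<^sup>2
        \<le> (mean Q (\<lambda>w. f (x(j := w)) * (1 - f (x(j := w)))))\<^sup>2 + (D' j x)\<^sup>2"
      unfolding g_def by (intro mean_times_compl_le Q f01[OF x] osc)
    moreover have "(L2_set (\<lambda>i. D' i x) (insert j I))\<^sup>2
        = (D' j x)\<^sup>2 + (L2_set (\<lambda>i. D' i x) I)\<^sup>2"
      using insert.hyps by (simp add: L2_set_def sum_nonneg)
    ultimately have "sqrt ((g x * (1 - g x))\<^sup>2 + (L2_set (\<lambda>i. D' i x) I)\<^sup>2)
        \<le> sqrt ((mean Q (\<lambda>w. f (x(j := w)) * (1 - f (x(j := w)))))\<^sup>2
              + (L2_set (\<lambda>i. D' i x) (insert j I))\<^sup>2)"
      by simp
    also have "\<dots> \<le> mean Q (\<lambda>w. ?R (x(j := w)))"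
      unfolding D'_def by (rule sqrt_sum_squares_mean_le)
    finally show ?thesis .
  qed
  have "mean ?X g * (1 - mean ?X g)
      \<le> mean ?X (\<lambda>x. sqrt ((g x * (1 - g x))\<^sup>2 + (L2_set (\<lambda>i. D' i x) I)\<^sup>2))"
    by (intro insert.IH g01 D')
  also have "\<dots> \<le> mean ?X (\<lambda>x. mean Q (\<lambda>w. ?R (x(j := w))))"
    by (intro mean_mono step)
  finally show ?case
    unfolding mean_PiE_insert[OF insert.hyps(2)] g_def .
qed

section \<open>The line boundary of a set of density at most one half\<close>

definition line_boundary :: "'i set \<Rightarrow> 'a set \<Rightarrow> ('i \<Rightarrow> 'a) set \<Rightarrow> ('i \<Rightarrow> 'a) set" where
  "line_boundary I Q A =
     {x \<in> I \<rightarrow>\<^sub>E Q. \<exists>i\<in>I. \<exists>y\<in>Q. \<exists>z\<in>Q. x(i := y) \<in> A \<and> x(i := z) \<notin> A}"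

text \<open>The functional inequality is applied to the indicator of \<open>A\<close>. Then
  \<open>f (1 - f)\<close> vanishes, and the gradient has norm at most \<open>sqrt (card I)\<close>,
  being zero off the line boundary. A density of at most 1/2 keeps the left side above half the
  density.\<close>

lemma card_line_boundary_ge:
  fixes A :: "('i \<Rightarrow> 'a) set"
  assumes I: "finite I" and Q: "finite Q" "Q \<noteq> {}" and A: "A \<subseteq> I \<rightarrow>\<^sub>E Q"
    and half: "2 * card A \<le> card (I \<rightarrow>\<^sub>E Q)"
  shows "real (card A) \<le> 2 * sqrt (real (card I)) * real (card (line_boundary I Q A))"
proof -
  let ?X = "I \<rightarrow>\<^sub>E Q"
  let ?B = "line_boundary I Q A"
  define M where "M = real (card ?X)"
  define a where "a = real (card A)"
  define f :: "('i \<Rightarrow> 'a) \<Rightarrow> real" where "f x = of_bool (x \<in> A)" for x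
  define D :: "'i \<Rightarrow> ('i \<Rightarrow> 'a) \<Rightarrow> real"
    where "D i x = of_bool (\<exists>y\<in>Q. \<exists>z\<in>Q. x(i := y) \<in> A \<and> x(i := z) \<notin> A)" for i x
  have finX: "finite ?X"
    using I Q by (simp add: finite_PiE)
  have "?X \<noteq> {}"
    using Q by (simp add: PiE_eq_empty_iff)
  then have M: "M > 0"
    using finX by (simp add: M_def card_gt_0_iff)
  have B: "?B \<subseteq> ?X"
    by (auto simp: line_boundary_def)
  have mean_f: "mean ?X f = a / M"
    using A finX by (simp add: mean_def f_def M_def a_def Int_absorb1)
  have "mean ?X f * (1 - mean ?X f)
      \<le> mean ?X (\<lambda>x. sqrt ((f x * (1 - f x))\<^sup>2 + (L2_set (\<lambda>i. D i x) I)\<^sup>2))"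
    by (rule mean_times_compl_le_mean_gradient[OF I Q]) (auto simp: f_def D_def)
  also have "\<dots> \<le> mean ?X (\<lambda>x. sqrt (real (card I)) * of_bool (x \<in> ?B))"
  proof (rule mean_mono)
    fix x assume x: "x \<in> ?X"
    have "(\<Sum>i\<in>I. (D i x)\<^sup>2) \<le> real (card I) * of_bool (x \<in> ?B)"
    proof (cases "x \<in> ?B")
      case True
      have "(\<Sum>i\<in>I. (D i x)\<^sup>2) \<le> (\<Sum>i\<in>I. 1)"
        by (rule sum_mono) (simp add: D_def)
      then show ?thesis
        using True by simp
    next
      case False
      then have "D i x = 0" if "i \<in> I" for i
        using that x by (auto simp: D_def line_boundary_def)
      then show ?thesis
        using False by simp
    qed
    then show "sqrt ((f x * (1 - f x))\<^sup>2 + (L2_set (\<lambda>i. D i x) I)\<^sup>2)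
        \<le> sqrt (real (card I)) * of_bool (x \<in> ?B)"
      by (cases "x \<in> ?B") (auto simp: f_def L2_set_def sum_nonneg)
  qed
  also have "\<dots> = sqrt (real (card I)) * (real (card ?B) / M)"
    unfolding mean_cmult using finX B by (simp add: mean_def M_def Int_absorb1)
  finally have "a / M * (1 - a / M) \<le> sqrt (real (card I)) * (real (card ?B) / M)"
    unfolding mean_f .
  moreover have "a / M * (1 / 2) \<le> a / M * (1 - a / M)"
    using half M by (intro mult_left_mono) (auto simp: field_simps a_def M_def)
  ultimately have "a / M * (1 / 2) \<le> sqrt (real (card I)) * (real (card ?B) / M)"
    by linarith
  then show ?thesis
    using M by (simp add: field_simps a_def)
qed

section \<open>Hamming neighbourhoods\<close>

definition hamming :: "'i set \<Rightarrow> ('i \<Rightarrow> 'a) \<Rightarrow> ('i \<Rightarrow> 'a) \<Rightarrow> nat" where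
  "hamming I x y = card {i \<in> I. x i \<noteq> y i}"

lemma hamming_upd_le:
  assumes "finite I"
  shows "hamming I (x(i := c)) y \<le> Suc (hamming I x y)"
proof -
  have "hamming I (x(i := c)) y \<le> card (insert i {i \<in> I. x i \<noteq> y i})"
    unfolding hamming_def using assms by (intro card_mono) auto
  also have "\<dots> \<le> Suc (hamming I x y)"
    unfolding hamming_def using assms by (simp add: card_insert_if)
  finally show ?thesis .
qed

definition hamming_nbhd :: "'i set \<Rightarrow> 'a set \<Rightarrow> nat \<Rightarrow> ('i \<Rightarrow> 'a) set \<Rightarrow> ('i \<Rightarrow> 'a) set" where
  "hamming_nbhd I Q k A = {x \<in> I \<rightarrow>\<^sub>E Q. \<exists>y\<in>A. hamming I x y \<le> k}"

lemma hamming_nbhd_mono: "k \<le> l \<Longrightarrow> hamming_nbhd I Q k A \<subseteq> hamming_nbhd I Q l A"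
  by (auto simp: hamming_nbhd_def intro: order_trans)

lemma subset_hamming_nbhd:
  assumes "A \<subseteq> I \<rightarrow>\<^sub>E Q"
  shows "A \<subseteq> hamming_nbhd I Q k A"
proof
  fix x assume "x \<in> A"
  moreover have "x \<in> I \<rightarrow>\<^sub>E Q"
    using assms \<open>x \<in> A\<close> by blast
  moreover have "hamming I x x \<le> k"
    by (simp add: hamming_def)
  ultimately show "x \<in> hamming_nbhd I Q k A"
    unfolding hamming_nbhd_def by blast
qed

lemma hamming_nbhd_upd:
  assumes "finite I" "i \<in> I" "c \<in> Q" "x \<in> hamming_nbhd I Q k A"
  shows "x(i := c) \<in> hamming_nbhd I Q (Suc k) A"
proof -
  obtain y where "y \<in> A" "hamming I x y \<le> k" "x \<in> I \<rightarrow>\<^sub>E Q"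
    using assms(4) by (auto simp: hamming_nbhd_def)
  moreover have "x(i := c) \<in> I \<rightarrow>\<^sub>E Q"
    using PiE_fun_upd[of c "\<lambda>_. Q" i x I] \<open>x \<in> I \<rightarrow>\<^sub>E Q\<close> assms by (simp add: insert_absorb)
  moreover have "hamming I (x(i := c)) y \<le> Suc k"
    using hamming_upd_le[OF assms(1), of x i c y] \<open>hamming I x y \<le> k\<close> by linarith
  ultimately show ?thesis
    unfolding hamming_nbhd_def by blast
qed

text \<open>Points on one line differ in a single coordinate. Hence \<open>x\<close> is one change
  away from a point of the middle neighbourhood, and if it lay in the \<open>k\<close>-neighbourhood
  the whole line would lie in the middle one.\<close>

lemma line_boundary_hamming_nbhd:
  assumes "finite I"
  shows "line_boundary I Q (hamming_nbhd I Q (Suc k) A)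
    \<subseteq> hamming_nbhd I Q (Suc (Suc k)) A - hamming_nbhd I Q k A"
proof
  fix x assume "x \<in> line_boundary I Q (hamming_nbhd I Q (Suc k) A)"
  then obtain i y z where x: "x \<in> I \<rightarrow>\<^sub>E Q" and i: "i \<in> I" and "y \<in> Q" and z: "z \<in> Q"
    and y: "x(i := y) \<in> hamming_nbhd I Q (Suc k) A" and "x(i := z) \<notin> hamming_nbhd I Q (Suc k) A"
    by (auto simp: line_boundary_def)
  then have "x \<notin> hamming_nbhd I Q k A"
    using hamming_nbhd_upd[OF assms] by metis
  moreover have "x i \<in> Q"
    using x i by auto
  then have "x \<in> hamming_nbhd I Q (Suc (Suc k)) A"
    using hamming_nbhd_upd[OF assms i _ y, of "x i"] by simp
  ultimately show "x \<in> hamming_nbhd I Q (Suc (Suc k)) A - hamming_nbhd I Q k A"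
    by simp
qed

text \<open>Linear growth: as long as the density stays at most 1/2, every two steps of the radius
  add \<open>card A / (2 * sqrt (card I))\<close> points. The bound is cleared of
  denominators.\<close>

lemma card_hamming_nbhd_ge:
  fixes A :: "('i \<Rightarrow> 'a) set"
  assumes I: "finite I" and Q: "finite Q" "Q \<noteq> {}" and A: "A \<subseteq> I \<rightarrow>\<^sub>E Q"
    and half: "2 * card (hamming_nbhd I Q (2 * m) A) \<le> card (I \<rightarrow>\<^sub>E Q)"
  shows "real (card A) * (2 * sqrt (real (card I)) + real m)
    \<le> 2 * sqrt (real (card I)) * real (card (hamming_nbhd I Q (2 * m) A))"
  using half
proof (induction m)
  case 0
  have "card A \<le> card (hamming_nbhd I Q 0 A)"
    using I Q by (intro card_mono subset_hamming_nbhd A) (simp add: hamming_nbhd_def finite_PiE)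
  then show ?case
    by (simp add: mult.commute[of "real (card A)"] mult_left_mono)
next
  case (Suc m)
  let ?N = "\<lambda>k. hamming_nbhd I Q k A" and ?s = "2 * sqrt (real (card I))"
  have fin: "finite (?N k)" for k
    using I Q by (simp add: hamming_nbhd_def finite_PiE)
  have mono: "card (?N k) \<le> card (?N l)" if "k \<le> l" for k l
    by (intro card_mono fin hamming_nbhd_mono that)
  have half': "2 * card (?N k) \<le> card (I \<rightarrow>\<^sub>E Q)" if "k \<le> 2 * Suc m" for k
    using mono[OF that] Suc.prems by linarith
  \<comment> \<open>Isoperimetry is used at the odd radius \<open>2 * m + 1\<close>, whose line
    boundary fits in the shell between the radii \<open>2 * m\<close> and
    \<open>2 * m + 2\<close>.\<close>
  have "real (card A) \<le> real (card (?N (Suc (2 * m))))"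
    using subset_hamming_nbhd[OF A] by (simp add: card_mono fin)
  also have "\<dots> \<le> ?s * real (card (line_boundary I Q (?N (Suc (2 * m)))))"
    by (rule card_line_boundary_ge[OF I Q _ half']) (auto simp: hamming_nbhd_def)
  also have "\<dots> \<le> ?s * real (card (?N (Suc (Suc (2 * m))) - ?N (2 * m)))"
    by (intro mult_left_mono of_nat_mono card_mono finite_Diff fin line_boundary_hamming_nbhd I) simp
  also have "\<dots> = ?s * (real (card (?N (Suc (Suc (2 * m))))) - real (card (?N (2 * m))))"
    using mono[of "2 * m" "Suc (Suc (2 * m))"]
    by (simp add: card_Diff_subset fin hamming_nbhd_mono of_nat_diff)
  finally have "real (card A) + ?s * real (card (?N (2 * m))) \<le> ?s * real (card (?N (2 * Suc m)))"
    by (simp add: algebra_simps)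
  then show ?case
    using Suc.IH[OF half'] by (simp add: algebra_simps)
qed

section \<open>A robust half cube\<close>

text \<open>An integral form of the bound \<open>4 ^ m / sqrt (2 * m + 1)\<close> for the central
  coefficient. The extra factor \<open>2 * m + 1\<close> is what lets the induction over the ratio
  of consecutive central coefficients close.\<close>

lemma central_binomial_square_le: "((2 * m) choose m)\<^sup>2 * (2 * m + 1) \<le> 16 ^ m"
proof (induction m)
  case (Suc m)
  define c d where "c = (2 * m) choose m" and "d = (2 * Suc m) choose (Suc m)"
  have sym: "Suc (2 * m) choose m = Suc (2 * m) choose Suc m"
    by (subst binomial_symmetric) simp_all
  have "Suc m * d = 2 * Suc m * (Suc (2 * m) choose m)"
    using Suc_times_binomial[of m "Suc (2 * m)"] by (simp add: d_def)
  also have "\<dots> = 2 * (Suc (2 * m) * c)"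
    unfolding sym c_def using Suc_times_binomial[of m "2 * m"] by simp
  finally have d: "Suc m * d = 2 * (2 * m + 1) * c"
    by simp
  have "(Suc m)\<^sup>2 * (d\<^sup>2 * (2 * Suc m + 1)) = (Suc m * d)\<^sup>2 * (2 * m + 3)"
    by (simp only: power_mult_distrib) (simp add: algebra_simps)
  also have "\<dots> = 4 * (2 * m + 1) * (2 * m + 3) * (c\<^sup>2 * (2 * m + 1))"
    unfolding d by (simp add: power2_eq_square algebra_simps)
  also have "\<dots> \<le> 4 * (2 * m + 1) * (2 * m + 3) * 16 ^ m"
    using Suc.IH unfolding c_def by (intro mult_left_mono) simp_all
  \<comment> \<open>The left factor \<open>4 * (2 * m + 1) * (2 * m + 3)\<close> equals
    \<open>16 * (m + 1)^2 - 4\<close>.\<close>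
  also have "\<dots> \<le> 16 * (Suc m)\<^sup>2 * 16 ^ m"
    by (intro mult_right_mono) (simp_all add: power2_eq_square algebra_simps)
  also have "\<dots> = (Suc m)\<^sup>2 * 16 ^ Suc m"
    by simp
  finally show ?case
    unfolding d_def by (simp only: mult_le_cancel1) simp
qed simp

lemma binomial_square_le: "(n choose k)\<^sup>2 * n \<le> 4 ^ n"
proof -
  have "(n choose k)\<^sup>2 * n \<le> (n choose (n div 2))\<^sup>2 * n"
    by (intro mult_right_mono power_mono binomial_maximum) simp_all
  also have "\<dots> \<le> 4 ^ n"
  proof (cases "even n")
    case True
    then obtain m where n: "n = 2 * m" by blast
    have "((2 * m) choose m)\<^sup>2 * (2 * m) \<le> ((2 * m) choose m)\<^sup>2 * (2 * m + 1)"
      by simp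
    also have "\<dots> \<le> 16 ^ m"
      by (rule central_binomial_square_le)
    finally show ?thesis
      by (simp add: n power_mult)
  next
    case False
    then obtain m where n: "n = Suc (2 * m)"
      by (metis oddE Suc_eq_plus1)
    \<comment> \<open>In Pascal's rule for the next central coefficient both summands equal
      \<open>n choose m\<close>, so the odd case follows from the even one.\<close>
    have d: "(2 * Suc m) choose Suc m = 2 * (n choose m)"
      using binomial_symmetric[of m "Suc (2 * m)"] by (simp add: n)
    have "4 * ((n choose m)\<^sup>2 * n) \<le> ((2 * Suc m) choose Suc m)\<^sup>2 * (2 * Suc m + 1)"
      unfolding d by (simp only: power_mult_distrib) (simp add: n)
    also have "\<dots> \<le> 16 ^ Suc m"
      by (rule central_binomial_square_le)
    also have "\<dots> = 4 * 4 ^ n"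
      by (simp add: n power_mult)
    finally show ?thesis
      by (simp add: n)
  qed
  finally show ?thesis .
qed

lemma binomial_sqrt_le: "real (n choose k) * sqrt (real n) \<le> 2 ^ n"
proof (rule power2_le_imp_le)
  have "(real (n choose k) * sqrt (real n))\<^sup>2 = real ((n choose k)\<^sup>2 * n)"
    by (simp add: power_mult_distrib)
  also have "\<dots> \<le> real (4 ^ n)"
    using binomial_square_le by (rule of_nat_mono)
  also have "\<dots> = (2 ^ n)\<^sup>2"
    by (simp add: power2_eq_square flip: power_mult_distrib)
  finally show "(real (n choose k) * sqrt (real n))\<^sup>2 \<le> (2 ^ n)\<^sup>2" .
qed simp

text \<open>The points are sorted by the set \<open>T\<close> of coordinates with value in
  \<open>U\<close>. Since \<open>U\<close> and \<open>Q - U\<close> have equal size, every fibre has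
  \<open>card U ^ card I\<close> points, so counting points reduces to counting subsets of
  \<open>I\<close>.\<close>

lemma card_PiE_support:
  fixes Q U :: "'a set"
  assumes I: "finite I" and Q: "finite Q" "U \<subseteq> Q" "card Q = 2 * card U"
  shows "card {x \<in> I \<rightarrow>\<^sub>E Q. P {i \<in> I. x i \<in> U}}
    = card {T. T \<subseteq> I \<and> P T} * card U ^ card I"
proof -
  let ?F = "\<lambda>T. \<Pi>\<^sub>E i\<in>I. if i \<in> T then U else Q - U"
  have supp: "{i \<in> I. x i \<in> U} = T" if "x \<in> ?F T" "T \<subseteq> I" for x T
  proof -
    have "x i \<in> U \<longleftrightarrow> i \<in> T" if "i \<in> I" for i
      using PiE_mem[OF \<open>x \<in> ?F T\<close> that] by (cases "i \<in> T") auto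
    then show ?thesis
      using \<open>T \<subseteq> I\<close> by blast
  qed
  have fibre: "x \<in> ?F T" if "x \<in> I \<rightarrow>\<^sub>E Q" "{i \<in> I. x i \<in> U} = T" for x T
    using that by (auto simp: PiE_iff)
  have eq: "{x \<in> I \<rightarrow>\<^sub>E Q. P {i \<in> I. x i \<in> U}} = (\<Union>T\<in>{T. T \<subseteq> I \<and> P T}. ?F T)"
  proof (intro equalityI subsetI)
    fix x assume "x \<in> {x \<in> I \<rightarrow>\<^sub>E Q. P {i \<in> I. x i \<in> U}}"
    then have "x \<in> ?F {i \<in> I. x i \<in> U}" "{i \<in> I. x i \<in> U} \<in> {T. T \<subseteq> I \<and> P T}"
      using fibre[OF _ refl] by simp_all
    then show "x \<in> (\<Union>T\<in>{T. T \<subseteq> I \<and> P T}. ?F T)"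
      by (rule UN_I[rotated])
  next
    fix x assume "x \<in> (\<Union>T\<in>{T. T \<subseteq> I \<and> P T}. ?F T)"
    then obtain T where T: "T \<subseteq> I" "P T" "x \<in> ?F T"
      by (elim UN_E CollectE conjE)
    have "x \<in> I \<rightarrow>\<^sub>E Q"
      using T(3) Q(2) by (auto simp: PiE_iff split: if_splits)
    then show "x \<in> {x \<in> I \<rightarrow>\<^sub>E Q. P {i \<in> I. x i \<in> U}}"
      using supp[OF T(3,1)] T(2) by simp
  qed
  have c: "card (?F T) = card U ^ card I" for T
  proof -
    have "card (Q - U) = card U"
      using Q by (simp add: card_Diff_subset finite_subset)
    then have "(\<Prod>i\<in>I. card (if i \<in> T then U else Q - U)) = (\<Prod>i\<in>I. card U)"
      by (intro prod.cong) auto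
    then show ?thesis
      using I by (simp add: card_PiE)
  qed
  have "card (\<Union>T\<in>{T. T \<subseteq> I \<and> P T}. ?F T) = (\<Sum>T\<in>{T. T \<subseteq> I \<and> P T}. card (?F T))"
  proof (rule card_UN_disjoint)
    show "\<forall>T\<in>{T. T \<subseteq> I \<and> P T}. finite (?F T)"
      using I Q by (auto intro!: finite_PiE dest: finite_subset)
    show "\<forall>T\<in>{T. T \<subseteq> I \<and> P T}. \<forall>T'\<in>{T. T \<subseteq> I \<and> P T}. T \<noteq> T' \<longrightarrow> ?F T \<inter> ?F T' = {}"
    proof (intro ballI impI equals0I)
      fix T T' x
      assume "T \<in> {T. T \<subseteq> I \<and> P T}" "T' \<in> {T. T \<subseteq> I \<and> P T}" "T \<noteq> T'" "x \<in> ?F T \<inter> ?F T'"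
      then show False
        using supp[of x T] supp[of x T'] by simp
    qed
  qed (use I in simp)
  then show ?thesis
    unfolding eq c by simp
qed

text \<open>Complementation matches the subsets below half size with those above, so only the middle
  layer is missing from two equal parts. That layer holds at most half of all subsets once
  \<open>sqrt (card I) \<ge> 2\<close>, whence the hypothesis \<open>card I \<ge> 4\<close>.\<close>

lemma card_small_subsets:
  assumes I: "finite I" and I4: "card I \<ge> 4"
  shows "2 * card {T. T \<subseteq> I \<and> 2 * card T < card I} \<le> 2 ^ card I"
    and "2 ^ card I \<le> 4 * card {T. T \<subseteq> I \<and> 2 * card T < card I}"
proof -
  let ?N = "card I"
  let ?S = "{T. T \<subseteq> I \<and> 2 * card T < ?N}"
  let ?L = "{T. T \<subseteq> I \<and> 2 * card T > ?N}"
  let ?M = "{T. T \<subseteq> I \<and> 2 * card T = ?N}"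
  have cardC: "card (I - T) = ?N - card T" "card T \<le> ?N" if "T \<subseteq> I" for T
    using that I by (auto simp: card_Diff_subset finite_subset card_mono)
  have "bij_betw (\<lambda>T. I - T) ?S ?L"
  proof (rule bij_betw_byWitness[where f' = "\<lambda>T. I - T"])
    show "(\<lambda>T. I - T) ` ?S \<subseteq> ?L"
      using cardC by fastforce
    show "(\<lambda>T. I - T) ` ?L \<subseteq> ?S"
    proof (rule image_subsetI)
      fix T assume "T \<in> ?L"
      then show "I - T \<in> ?S"
        using cardC[of T] by auto
    qed
  qed auto
  then have SL: "card ?S = card ?L"
    by (rule bij_betw_same_card)
  have "Pow I = ?S \<union> ?L \<union> ?M"
    by auto
  then have "2 ^ ?N = card (?S \<union> ?L \<union> ?M)"
    using I by (metis card_Pow)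
  also have "\<dots> = card (?S \<union> ?L) + card ?M"
    using I by (intro card_Un_disjoint) auto
  also have "card (?S \<union> ?L) = card ?S + card ?L"
    using I by (intro card_Un_disjoint) auto
  finally have total: "2 ^ ?N = 2 * card ?S + card ?M"
    by (simp add: SL)
  then show "2 * card ?S \<le> 2 ^ ?N"
    by simp
  have "card ?M \<le> card {T. T \<subseteq> I \<and> card T = ?N div 2}"
    using I by (intro card_mono) auto
  also have "\<dots> = ?N choose (?N div 2)"
    by (rule n_subsets[OF I])
  finally have M: "card ?M \<le> ?N choose (?N div 2)" .
  have "sqrt 4 \<le> sqrt (real ?N)"
    using I4 by (intro real_sqrt_le_mono) simp
  then have "real (card ?M) * 2 \<le> real (?N choose (?N div 2)) * sqrt (real ?N)"
    using M by (intro mult_mono) auto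
  also have "\<dots> \<le> 2 ^ ?N"
    by (rule binomial_sqrt_le)
  finally have "real (2 * card ?M) \<le> real (2 ^ ?N)"
    by simp
  then have "2 * card ?M \<le> 2 ^ ?N"
    by (simp only: of_nat_le_iff)
  then show "2 ^ ?N \<le> 4 * card ?S"
    using total by linarith
qed

text \<open>The family consists of at most \<open>D\<close> layers, each no larger than
  \<open>2 ^ N / sqrt N\<close> with \<open>N = card I\<close>.\<close>

lemma card_nearly_half_subsets:
  assumes I: "finite I"
  shows "real (card {T. T \<subseteq> I \<and> 2 * card T < card I \<and> card I \<le> 2 * (card T + D)}) * sqrt (real (card I))
    \<le> real D * 2 ^ card I"
proof -
  let ?N = "card I"
  let ?R = "{k. 2 * k < ?N \<and> ?N \<le> 2 * (k + D)}"
  \<comment> \<open>The sizes are the \<open>D\<close> integers just below \<open>N / 2\<close>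
    rounded up; truncated subtraction can only shorten the interval.\<close>
  have sub: "?R \<subseteq> {(?N + 1) div 2 - D..<(?N + 1) div 2}"
    by auto
  have "card ?R \<le> D"
    using card_mono[OF _ sub] by simp
  have finR: "finite ?R"
    using finite_subset[OF sub] by simp
  have "{T. T \<subseteq> I \<and> 2 * card T < ?N \<and> ?N \<le> 2 * (card T + D)} = (\<Union>k\<in>?R. {T. T \<subseteq> I \<and> card T = k})"
    by auto
  then have "card {T. T \<subseteq> I \<and> 2 * card T < ?N \<and> ?N \<le> 2 * (card T + D)} \<le> (\<Sum>k\<in>?R. ?N choose k)"
    using card_UN_le[OF finR, of "\<lambda>k. {T. T \<subseteq> I \<and> card T = k}"] by (simp add: n_subsets[OF I])
  then have "real (card {T. T \<subseteq> I \<and> 2 * card T < ?N \<and> ?N \<le> 2 * (card T + D)}) * sqrt (real ?N)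
      \<le> real (\<Sum>k\<in>?R. ?N choose k) * sqrt (real ?N)"
    by (intro mult_right_mono of_nat_mono) auto
  also have "\<dots> = (\<Sum>k\<in>?R. real (?N choose k) * sqrt (real ?N))"
    by (simp add: sum_distrib_right)
  also have "\<dots> \<le> (\<Sum>k\<in>?R. 2 ^ ?N)"
    by (intro sum_mono binomial_sqrt_le)
  also have "\<dots> \<le> real D * 2 ^ ?N"
    using \<open>card ?R \<le> D\<close> by simp
  finally show ?thesis .
qed

text \<open>The strict inequality leaves the middle layer out, which keeps the set at or below half
  of the cube also for even \<open>card I\<close>.\<close>

definition low_half :: "'i set \<Rightarrow> 'a set \<Rightarrow> 'a set \<Rightarrow> ('i \<Rightarrow> 'a) set" where
  "low_half I Q U = {x \<in> I \<rightarrow>\<^sub>E Q. 2 * card {i \<in> I. x i \<in> U} < card I}"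

section \<open>Size and robust core of the half cube\<close>

context
  fixes I :: "'i set" and Q U :: "'a set"
  assumes I: "finite I" and Q: "finite Q" "U \<subseteq> Q" "card Q = 2 * card U" "U \<noteq> {}"
    and I4: "card I \<ge> 4"
begin

lemma card_low_half:
  "card (low_half I Q U) = card {T. T \<subseteq> I \<and> 2 * card T < card I} * card U ^ card I"
  unfolding low_half_def by (rule card_PiE_support[OF I Q(1-3)])

lemma low_half_nonempty: "low_half I Q U \<noteq> {}"
proof -
  have "card U > 0"
    using Q finite_subset by (auto simp: card_gt_0_iff)
  moreover have "card {T. T \<subseteq> I \<and> 2 * card T < card I} > 0"
    using card_small_subsets(2)[OF I I4] by (metis gr0I mult_0_right not_numeral_le_zero
        power_eq_0_iff le_zero_eq zero_neq_numeral)
  ultimately have "card (low_half I Q U) > 0"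
    by (simp add: card_low_half)
  then show ?thesis
    by auto
qed

lemma card_low_half_le: "2 * card (low_half I Q U) \<le> card (I \<rightarrow>\<^sub>E Q)"
proof -
  have "2 * card (low_half I Q U) \<le> 2 ^ card I * card U ^ card I"
    unfolding card_low_half using card_small_subsets(1)[OF I I4]
    by (metis mult.assoc mult_le_mono1)
  also have "\<dots> = card (I \<rightarrow>\<^sub>E Q)"
    using I Q by (simp add: card_PiE power_mult_distrib)
  finally show ?thesis .
qed

text \<open>With \<open>D\<close> changes at most \<open>D\<close> coordinates enter
  \<open>U\<close>, so only points in the \<open>D\<close> layers just below the threshold can
  leave. These layers are a fraction of at most \<open>D / sqrt (card I)\<close> of the cube, and
  the factor 4 in the hypothesis is there because the half cube is only known to fill a
  quarter.\<close>

lemma card_low_half_robust_ge: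
  assumes D: "4 * real D \<le> (1 - r) * sqrt (real (card I))"
  shows "r * real (card (low_half I Q U))
    \<le> real (card {x \<in> low_half I Q U. \<forall>y\<in>I \<rightarrow>\<^sub>E Q. hamming I x y \<le> D \<longrightarrow> y \<in> low_half I Q U})"
    (is "_ \<le> real (card ?R)")
proof -
  let ?K = "low_half I Q U"
  let ?s = "sqrt (real (card I))"
  define F where "F = {T. T \<subseteq> I \<and> 2 * card T < card I \<and> card I \<le> 2 * (card T + D)}"
  define S where "S = {T. T \<subseteq> I \<and> 2 * card T < card I}"
  define B where "B = {x \<in> I \<rightarrow>\<^sub>E Q. 2 * card {i \<in> I. x i \<in> U} < card I
    \<and> card I \<le> 2 * (card {i \<in> I. x i \<in> U} + D)}"
  have finX: "finite (I \<rightarrow>\<^sub>E Q)"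
    using I Q by (simp add: finite_PiE)
  have cB: "card B = card F * card U ^ card I"
    unfolding B_def F_def by (rule card_PiE_support[OF I Q(1-3)])
  have cK: "card ?K = card S * card U ^ card I"
    unfolding S_def by (rule card_low_half)
  have "?K - B \<subseteq> ?R"
  proof
    fix x assume x: "x \<in> ?K - B"
    have "y \<in> ?K" if y: "y \<in> I \<rightarrow>\<^sub>E Q" "hamming I x y \<le> D" for y
    proof -
      have "card {i \<in> I. y i \<in> U} \<le> card ({i \<in> I. x i \<in> U} \<union> {i \<in> I. x i \<noteq> y i})"
        using I by (intro card_mono) auto
      also have "\<dots> \<le> card {i \<in> I. x i \<in> U} + D"
        using y(2) card_Un_le[of "{i \<in> I. x i \<in> U}" "{i \<in> I. x i \<noteq> y i}"]
        unfolding hamming_def by linarith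
      finally show ?thesis
        using x y(1) by (auto simp: low_half_def B_def)
    qed
    then show "x \<in> ?R"
      using x by simp
  qed
  then have "card (?K - B) \<le> card ?R"
    using finX by (intro card_mono) (auto simp: low_half_def)
  then have "card ?K \<le> card ?R + card B"
    using diff_card_le_card_Diff[of B ?K] finX by (simp add: B_def)
  moreover have "real (card F) \<le> (1 - r) * real (card S)"
  proof -
    have s: "?s > 0"
      using I4 by simp
    have "4 * (real (card F) * ?s) \<le> 4 * (real D * 2 ^ card I)"
      unfolding F_def using card_nearly_half_subsets[OF I] by (intro mult_left_mono) auto
    also have "\<dots> = 4 * real D * 2 ^ card I"
      by simp
    also have "\<dots> \<le> (1 - r) * ?s * 2 ^ card I"
      by (intro mult_right_mono D) simp
    also have "\<dots> \<le> (1 - r) * ?s * real (4 * card S)"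
    proof (rule mult_left_mono)
      show "2 ^ card I \<le> real (4 * card S)"
        using card_small_subsets(2)[OF I I4] unfolding S_def
        by (metis of_nat_le_iff of_nat_numeral of_nat_power)
      show "0 \<le> (1 - r) * ?s"
        using D by (rule order_trans[rotated]) simp
    qed
    finally have "real (card F) * ?s \<le> (1 - r) * real (card S) * ?s"
      by (simp add: mult_ac)
    then show ?thesis
      using s by simp
  qed
  then have "real (card B) \<le> (1 - r) * real (card ?K)"
    unfolding cB cK of_nat_mult mult.assoc[symmetric] by (intro mult_right_mono) auto
  ultimately show ?thesis
    by (simp add: algebra_simps)
qed

end

section \<open>Images\<close>

lemma finite_tensor_index: "finite (tensor_index n h)"
  by (simp add: tensor_index_def)

lemma card_tensor_index: "card (tensor_index n h) = n\<^sup>2 * h"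
  by (simp add: tensor_index_def card_cartesian_product power2_eq_square)

lemma levels_eq_image: "levels b = (\<lambda>x. real x / (2 ^ b - 1)) ` {..2 ^ b - 1}"
  by (auto simp: levels_def)

lemma finite_levels: "finite (levels b)"
  by (simp add: levels_eq_image)

lemma two_power_gt_one: "1 \<le> b \<Longrightarrow> (2::real) \<le> 2 ^ b"
  using power_increasing[of 1 b "2::real"] by simp

lemma card_levels:
  assumes "b \<ge> 1"
  shows "card (levels b) = 2 ^ b"
proof -
  have "inj_on (\<lambda>x. real x / (2 ^ b - 1)) {..2 ^ b - 1}"
    using two_power_gt_one[OF assms] by (auto simp: inj_on_def)
  then show ?thesis
    by (simp add: levels_eq_image card_image)
qed

lemma levels_diff:
  assumes "b \<ge> 1" "v \<in> levels b" "w \<in> levels b"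
  shows "\<bar>v - w\<bar> \<le> 1" and "v \<noteq> w \<Longrightarrow> 1 / (2 ^ b - 1) \<le> \<bar>v - w\<bar>"
proof -
  have q: "(2::real) ^ b - 1 > 0"
    using two_power_gt_one[OF assms(1)] by simp
  obtain x y :: nat where x: "v = real x / (2 ^ b - 1)" "x \<le> 2 ^ b - 1"
    and y: "w = real y / (2 ^ b - 1)" "y \<le> 2 ^ b - 1"
    using assms by (auto simp: levels_def)
  have d: "\<bar>v - w\<bar> = \<bar>real x - real y\<bar> / (2 ^ b - 1)"
    unfolding x(1) y(1) diff_divide_distrib[symmetric] by (rule abs_div_pos[OF q, symmetric])
  have "real (2 ^ b - 1) = 2 ^ b - 1"
    by (simp add: of_nat_diff)
  then have "real x \<le> 2 ^ b - 1" "real y \<le> 2 ^ b - 1"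
    using of_nat_mono[OF x(2), where 'a = real] of_nat_mono[OF y(2), where 'a = real] by simp_all
  then show "\<bar>v - w\<bar> \<le> 1"
    unfolding d using q by (simp add: abs_le_iff)
  show "1 / (2 ^ b - 1) \<le> \<bar>v - w\<bar>" if "v \<noteq> w"
  proof -
    have "x \<noteq> y"
      using that x(1) y(1) by auto
    then have "1 \<le> \<bar>real x - real y\<bar>"
      by linarith
    then show ?thesis
      unfolding d using q by (intro divide_right_mono) auto
  qed
qed

section \<open>Comparison of perturbation size with Hamming distance\<close>

lemma lp_norm_0_diff: "lp_norm n h 0 (\<lambda>i. x i - y i) = real (hamming (tensor_index n h) x y)"
  by (simp add: lp_norm_def hamming_def)

text \<open>A changed entry adds at most 1 to the sum of \<open>p\<close>th powers. The assumption
  \<open>c \<ge> 1\<close> allows \<open>c\<close> to be replaced by \<open>c ^ p\<close>, so that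
  the \<open>p\<close>th root returns \<open>c\<close> itself.\<close>

lemma lp_norm_diff_le:
  assumes b: "b \<ge> 1" and xy: "x \<in> images n h b" "y \<in> images n h b"
    and c: "c \<ge> 1" and ham: "real (hamming (tensor_index n h) x y) \<le> c * real n"
  shows "lp_norm n h p (\<lambda>i. x i - y i) \<le> c * real n powr (1 / real (max p 1))"
proof (cases "p = 0")
  case True
  then show ?thesis
    using ham by (simp add: lp_norm_0_diff)
next
  case False
  let ?T = "tensor_index n h"
  let ?t = "c * real n powr (1 / real p)"
  have "(\<Sum>i\<in>?T. \<bar>x i - y i\<bar> ^ p) \<le> (\<Sum>i\<in>?T. of_bool (x i \<noteq> y i))"
  proof (rule sum_mono)
    fix i assume "i \<in> ?T"
    then have "x i \<in> levels b" "y i \<in> levels b"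
      using xy by (auto simp: images_def)
    then show "\<bar>x i - y i\<bar> ^ p \<le> of_bool (x i \<noteq> y i)"
      using levels_diff(1)[OF b] False by (auto intro: power_le_one simp: zero_power)
  qed
  also have "\<dots> = real (hamming ?T x y)"
    using finite_tensor_index[of n h] by (simp add: hamming_def Int_def)
  also have "\<dots> \<le> c * real n"
    by (rule ham)
  also have "\<dots> \<le> c ^ p * real n"
    using c False by (intro mult_right_mono self_le_power) auto
  also have "\<dots> = ?t ^ p"
    using False by (cases "n = 0") (simp_all add: power_mult_distrib powr_power)
  finally have "root p (\<Sum>i\<in>?T. \<bar>x i - y i\<bar> ^ p) \<le> root p (?t ^ p)"
    using False by (intro real_root_le_mono) auto
  also have "\<dots> = ?t"
    using False c by (intro real_root_power_cancel) auto
  finally have "root p (\<Sum>i\<in>?T. \<bar>x i - y i\<bar> ^ p) \<le> ?t" .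
  moreover have "max p 1 = p"
    using False by simp
  ultimately show ?thesis
    using False by (simp add: lp_norm_def)
qed

text \<open>The converse comparison: a changed entry adds at least
  \<open>(1 / (2 ^ b - 1)) ^ p\<close>, which cancels against the bound on the norm. Now
  \<open>c \<le> 1\<close> is needed for \<open>c ^ p \<le> c\<close>.\<close>

lemma hamming_le_of_lp_norm:
  assumes b: "b \<ge> 1" and xy: "x \<in> images n h b" "y \<in> images n h b"
    and c: "0 \<le> c" "c \<le> 1"
    and lp: "lp_norm n h p (\<lambda>i. x i - y i) \<le> c / (2 ^ b - 1) * real n powr (1 / real (max p 1))"
  shows "real (hamming (tensor_index n h) x y) \<le> c * real n"
proof (cases "p = 0")
  case True
  have "c / (2 ^ b - 1) \<le> c / 1"
    using two_power_gt_one[OF b] c by (intro divide_left_mono) auto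
  then have "c / (2 ^ b - 1) * real n \<le> c * real n"
    by (intro mult_right_mono) auto
  then show ?thesis
    using True lp by (simp add: lp_norm_0_diff)
next
  case False
  let ?T = "tensor_index n h"
  let ?S = "\<Sum>i\<in>?T. \<bar>x i - y i\<bar> ^ p"
  define q :: real where "q = 2 ^ b - 1"
  have q: "q > 0"
    using two_power_gt_one[OF b] by (simp add: q_def)
  have max: "max p 1 = p"
    using False by simp
  have S: "?S \<ge> 0"
    by (simp add: sum_nonneg)
  have "real (hamming ?T x y) * (1 / q) ^ p = (\<Sum>i\<in>?T. of_bool (x i \<noteq> y i) * (1 / q) ^ p)"
    using finite_tensor_index[of n h] by (simp add: hamming_def Int_def flip: sum_distrib_right)
  also have "\<dots> \<le> ?S"
  proof (rule sum_mono)
    fix i assume "i \<in> ?T"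
    then have "x i \<in> levels b" "y i \<in> levels b"
      using xy by (auto simp: images_def)
    then show "of_bool (x i \<noteq> y i) * (1 / q) ^ p \<le> \<bar>x i - y i\<bar> ^ p"
      using levels_diff(2)[OF b] q by (auto simp: q_def intro!: power_mono)
  qed
  also have "\<dots> = root p ?S ^ p"
    using False S by simp
  also have "\<dots> \<le> (c / q * real n powr (1 / real p)) ^ p"
    using lp False S max by (intro power_mono) (auto simp: lp_norm_def q_def)
  also have "\<dots> = c ^ p * real n * (1 / q) ^ p"
    using False by (cases "n = 0") (simp_all add: power_mult_distrib power_divide powr_power)
  finally have "real (hamming ?T x y) \<le> c ^ p * real n"
    using q by (simp add: power_divide divide_right_mono divide_le_cancel)
  also have "\<dots> \<le> c * real n"
    using c False power_decreasing[of 1 p c] by (intro mult_right_mono) auto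
  finally show ?thesis .
qed

text \<open>The hypothesis on \<open>m\<close> says \<open>r * (s + m) > s\<close> for
  \<open>s = 2 * sqrt N\<close>, where \<open>N\<close> is the number of entries. The growth bound
  applied to the robust members of \<open>K\<close> would give the opposite inequality.\<close>

lemma not_robust_class:
  assumes b: "b \<ge> 1" and r: "r > 0" and K: "K \<in> induced_classes n h b Y C"
    and int: "interesting_class n h b K"
    and m: "2 * sqrt (real (card (tensor_index n h))) * (1 - r) < r * real m"
    and d: "\<And>x y. \<lbrakk>x \<in> images n h b; y \<in> images n h b; hamming (tensor_index n h) y x \<le> 2 * m\<rbrakk>
              \<Longrightarrow> lp_norm n h p (\<lambda>i. x i - y i) \<le> d"
  shows "\<not> robust_class n h b C r p d K"
proof
  assume rob: "robust_class n h b C r p d K"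
  let ?T = "tensor_index n h" and ?L = "levels b"
  define A where "A = {x \<in> K. robust_image n h b C p d x}"
  let ?N = "hamming_nbhd ?T ?L (2 * m) A"
  let ?s = "2 * sqrt (real (card ?T))"
  obtain y where Ky: "K = {x \<in> images n h b. C x = y}"
    using K by (auto simp: induced_classes_def)
  have finX: "finite (images n h b)"
    by (simp add: images_def finite_PiE finite_tensor_index finite_levels)
  then have finK: "finite K"
    by (simp add: Ky)
  have rA: "r * real (card K) \<le> real (card A)" and K0: "real (card K) > 0"
    using rob finK by (auto simp: robust_class_def A_def card_gt_0_iff)
  \<comment> \<open>By robustness \<open>2 * m\<close> changes to a point of \<open>A\<close> never
    leave \<open>K\<close>. The neighbourhood therefore inherits the density bound of the
    interesting class.\<close>
  have "?N \<subseteq> K"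
  proof
    fix x assume "x \<in> ?N"
    then obtain z where x: "x \<in> images n h b" and z: "z \<in> A" "hamming ?T x z \<le> 2 * m"
      by (auto simp: hamming_nbhd_def images_def)
    then have "z \<in> images n h b" "C z = y" "robust_image n h b C p d z"
      by (auto simp: A_def Ky)
    then have "C z = C x"
      using d[OF _ x z(2)] x by (auto simp: robust_image_def)
    then show "x \<in> K"
      using x \<open>C z = y\<close> by (simp add: Ky)
  qed
  then have NK: "card ?N \<le> card K"
    by (intro card_mono finK)
  have L: "finite ?L" "?L \<noteq> {}"
    using card_levels[OF b] finite_levels by auto
  have "2 * card K \<le> card (images n h b)"
    using int by (simp add: interesting_class_def)
  then have "real (card A) * (?s + real m) \<le> ?s * real (card ?N)"
    using NK by (intro card_hamming_nbhd_ge finite_tensor_index L) (auto simp: A_def Ky images_def)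
  also have "\<dots> \<le> ?s * real (card K)"
    using NK by (intro mult_left_mono) auto
  finally have "r * real (card K) * (?s + real m) \<le> ?s * real (card K)"
    using mult_right_mono[OF rA, of "?s + real m"] by simp
  then have "(r * (?s + real m)) * real (card K) \<le> ?s * real (card K)"
    by (simp add: mult_ac)
  then have "r * (?s + real m) \<le> ?s"
    using K0 by simp
  then show False
    using m by (simp add: algebra_simps)
qed

text \<open>One label is given to the half cube and another to the rest. With a single label the
  only class would be the set of all images, which is not interesting, hence
  \<open>card Y \<ge> 2\<close>.\<close>

lemma ex_robust_class:
  fixes Y :: "'y set"
  assumes b: "b \<ge> 1" and Y: "card Y \<ge> 2" and N: "card (tensor_index n h) \<ge> 4"
    and D: "4 * real D \<le> (1 - r) * sqrt (real (card (tensor_index n h)))"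
    and d: "\<And>x y. \<lbrakk>x \<in> images n h b; y \<in> images n h b; lp_norm n h p (\<lambda>i. x i - y i) \<le> d\<rbrakk>
              \<Longrightarrow> hamming (tensor_index n h) x y \<le> D"
  shows "\<exists>C \<in> classifiers n h b Y. \<exists>K \<in> induced_classes n h b Y C.
    interesting_class n h b K \<and> robust_class n h b C r p d K"
proof -
  let ?T = "tensor_index n h"
  obtain Y' where "Y' \<subseteq> Y" "card Y' = 2"
    using Y obtain_subset_with_card_n by metis
  then obtain u v where uv: "u \<in> Y" "v \<in> Y" "u \<noteq> v"
    by (auto simp: card_2_iff)
  have card_L: "card (levels b) = 2 * 2 ^ (b - 1)"
    using card_levels[OF b] b by (simp flip: power_Suc)
  then have "2 ^ (b - 1) \<le> card (levels b)"
    by simp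
  \<comment> \<open>Any half of the levels serves, since only the size of \<open>U\<close> enters
    the counting.\<close>
  then obtain U where U: "U \<subseteq> levels b" "card U = 2 ^ (b - 1)"
    using obtain_subset_with_card_n by metis
  then have U': "card (levels b) = 2 * card U" "U \<noteq> {}"
    using card_L by auto
  define K where "K = low_half ?T (levels b) U"
  note half = finite_tensor_index finite_levels U(1) U' N
  have KX: "K \<subseteq> images n h b"
    by (auto simp: K_def low_half_def images_def)
  have K0: "K \<noteq> {}"
    unfolding K_def by (rule low_half_nonempty[OF half])
  have "2 * card K \<le> card (images n h b)"
    unfolding K_def images_def by (rule card_low_half_le[OF half])
  then have int: "interesting_class n h b K"
    using K0 by (simp add: interesting_class_def)
  define C where "C = (\<lambda>x\<in>images n h b. if x \<in> K then u else v)"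
  have "C \<in> classifiers n h b Y"
    using uv by (auto simp: C_def classifiers_def)
  moreover have "K \<in> induced_classes n h b Y C"
  proof -
    have "K = {x \<in> images n h b. C x = u}"
      using KX uv by (auto simp: C_def)
    then show ?thesis
      using uv(1) by (auto simp: induced_classes_def)
  qed
  moreover have "robust_class n h b C r p d K"
  proof -
    let ?R = "{x \<in> K. \<forall>y\<in>images n h b. hamming ?T x y \<le> D \<longrightarrow> y \<in> K}"
    have "?R \<subseteq> {x \<in> K. robust_image n h b C p d x}"
      using KX d by (auto simp: robust_image_def C_def)
    moreover have "finite K"
      by (rule finite_subset[OF KX]) (simp add: images_def finite_PiE finite_tensor_index finite_levels)
    ultimately have "card ?R \<le> card {x \<in> K. robust_image n h b C p d x}"
      by (intro card_mono) auto
    moreover have "r * real (card K) \<le> real (card ?R)"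
      unfolding K_def images_def by (rule card_low_half_robust_ge[OF half D])
    ultimately show ?thesis
      using K0 unfolding robust_class_def by linarith
  qed
  ultimately show ?thesis
    using int by blast
qed

theorem corollary1:
  fixes h b p :: nat and r :: real
  assumes "h \<ge> 1" and "b \<ge> 1" and "0 < r" and "r < 1"
  shows "\<exists>(c1::real) (c2::real) (n0::nat). c1 \<ge> c2 \<and> c2 > 0 \<and>
    (\<forall>n\<ge>n0. \<forall>Y :: 'y set. finite Y \<longrightarrow>
      \<not> (\<exists>C \<in> classifiers n h b Y. \<exists>K \<in> induced_classes n h b Y C.
            interesting_class n h b K \<and>
            robust_class n h b C r p (c1 * real n powr (1 / real (max p 1))) K) \<and>
      (card Y \<ge> 2 \<longrightarrow>
        (\<exists>C \<in> classifiers n h b Y. \<exists>K \<in> induced_classes n h b Y C.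
            interesting_class n h b K \<and>
            robust_class n h b C r p (c2 * real n powr (1 / real (max p 1))) K)))"
proof -
  \<comment> \<open>\<open>c1 * n\<close> has to dominate twice the number \<open>m\<close> of
    double steps chosen below; the summand 2 absorbs the rounding in \<open>m\<close>. The value of
    \<open>c0\<close> fits the condition on \<open>D\<close> in \<open>ex_robust_class\<close>, and
    \<open>c2\<close> rescales it by the spacing of the levels.\<close>
  define c1 where "c1 = 4 * sqrt (real h) / r + 2"
  define c0 where "c0 = (1 - r) / 4"
  define c2 where "c2 = c0 / (2 ^ b - 1)"
  have c0: "0 < c0" "c0 \<le> 1"
    using assms by (auto simp: c0_def)
  have c1: "c1 \<ge> 2"
    using assms by (simp add: c1_def)
  have "c2 \<le> c0 / 1"
    unfolding c2_def using two_power_gt_one[OF assms(2)] c0 by (intro divide_left_mono) auto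
  then have "c1 \<ge> c2"
    using c0 c1 by simp
  moreover have "c2 > 0"
    using c0 two_power_gt_one[OF assms(2)] by (simp add: c2_def)
  moreover have "\<not> robust_class n h b C r p (c1 * real n powr (1 / real (max p 1))) K"
    if n: "n \<ge> 2" and K: "K \<in> induced_classes n h b Y C" "interesting_class n h b K"
    for n and Y :: "'y set" and C K
  proof (rule not_robust_class[OF assms(2,3) K])
    \<comment> \<open>The choice makes \<open>r * m\<close> at least \<open>2 * sqrt N\<close>, with
      \<open>N = n^2 * h\<close>; the required strict inequality follows from
      \<open>r > 0\<close>.\<close>
    define m where "m = nat \<lceil>2 * real n * sqrt (real h) / r\<rceil>"
    have s: "sqrt (real (card (tensor_index n h))) = real n * sqrt (real h)"
      by (simp add: card_tensor_index real_sqrt_mult)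
    have s0: "real n * sqrt (real h) > 0"
      using n assms by simp
    have m_ge: "2 * real n * sqrt (real h) / r \<le> real m"
      unfolding m_def by (rule real_nat_ceiling_ge)
    have "2 * (real n * sqrt (real h)) * (1 - r) < 2 * (real n * sqrt (real h)) * 1"
      using s0 assms by (intro mult_strict_left_mono) auto
    also have "\<dots> \<le> r * real m"
      using m_ge assms by (simp add: field_simps)
    finally show "2 * sqrt (real (card (tensor_index n h))) * (1 - r) < r * real m"
      unfolding s .
    have "0 \<le> 2 * real n * sqrt (real h) / r"
      using assms by simp
    then have "real m \<le> 2 * real n * sqrt (real h) / r + 1"
      unfolding m_def by linarith
    then have "real (2 * m) \<le> 2 * (2 * real n * sqrt (real h) / r + 1)"
      by simp
    also have "\<dots> = real n * (4 * sqrt (real h) / r) + 2"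
      by simp
    finally have "real (2 * m) \<le> real n * (4 * sqrt (real h) / r) + 2" .
    then have m_le: "real (2 * m) \<le> c1 * real n"
      using n by (simp add: c1_def algebra_simps)
    fix x y
    assume xy: "x \<in> images n h b" "y \<in> images n h b" "hamming (tensor_index n h) y x \<le> 2 * m"
    have "hamming (tensor_index n h) x y = hamming (tensor_index n h) y x"
      by (simp add: hamming_def eq_commute)
    then have "real (hamming (tensor_index n h) x y) \<le> c1 * real n"
      using xy(3) m_le by linarith
    then show "lp_norm n h p (\<lambda>i. x i - y i) \<le> c1 * real n powr (1 / real (max p 1))"
      using c1 by (intro lp_norm_diff_le[OF assms(2) xy(1,2)]) auto
  qed
  moreover have "\<exists>C \<in> classifiers n h b Y. \<exists>K \<in> induced_classes n h b Y C.
      interesting_class n h b K \<and>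
      robust_class n h b C r p (c2 * real n powr (1 / real (max p 1))) K"
    if n: "n \<ge> 2" and Y: "card Y \<ge> 2" for n and Y :: "'y set"
  proof (rule ex_robust_class[OF assms(2) Y])
    \<comment> \<open>This is where the threshold \<open>n \<ge> 2\<close> comes from: the half cube
      needs at least 4 coordinates.\<close>
    have "2\<^sup>2 * 1 \<le> n\<^sup>2 * h"
      using n assms by (intro mult_mono power_mono) auto
    then show "card (tensor_index n h) \<ge> 4"
      by (simp add: card_tensor_index)
    \<comment> \<open>Hamming distances are integers, so rounding \<open>c0 * n\<close> down loses
      nothing.\<close>
    define D where "D = nat \<lfloor>c0 * real n\<rfloor>"
    have "real D \<le> c0 * real n"
      using c0 by (simp add: D_def)
    then have "4 * real D \<le> (1 - r) * real n"
      by (simp add: c0_def)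
    also have "\<dots> \<le> (1 - r) * sqrt (real (card (tensor_index n h)))"
    proof (rule mult_left_mono)
      have "real n * 1 \<le> real n * sqrt (real h)"
        using assms by (intro mult_left_mono) auto
      then show "real n \<le> sqrt (real (card (tensor_index n h)))"
        by (simp add: card_tensor_index real_sqrt_mult)
    qed (use assms in simp)
    finally show "4 * real D \<le> (1 - r) * sqrt (real (card (tensor_index n h)))" .
    fix x y
    assume "x \<in> images n h b" "y \<in> images n h b"
      "lp_norm n h p (\<lambda>i. x i - y i) \<le> c2 * real n powr (1 / real (max p 1))"
    then have "real (hamming (tensor_index n h) x y) \<le> c0 * real n"
      using c0 unfolding c2_def by (intro hamming_le_of_lp_norm[OF assms(2)]) auto
    then show "hamming (tensor_index n h) x y \<le> D"
      unfolding D_def by (simp add: le_nat_floor)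
  qed
  ultimately show ?thesis
    by (intro exI[of _ c1] exI[of _ c2] exI[of _ "2::nat"]) blast
qed

end
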